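(* Let $V$ be a finite set and let $S$ and $T$ be zero-diagonal symmetric $V\times V$ matrices over $GF(2)$. Then $S\sim_{lc}T$ if and only if $S\sim_{mi}T$.
   Context: All matrices have entries in the two-element field $GF(2)$. A square matrix $S=(s_{ij})$ is symmetric if $s_{ij}=s_{ji}$ for all $i\neq j$, and zero-diagonal if $s_{ii}=0$ for all $i$. Toggling an entry means applying $x\mapsto x+1$ to it. Simple local complement: if $S$ is a symmetric matrix and $i$ is an index, the simple local complement $S^{i}$ of $S$ at $i$ is the symmetric matrix obtained from $S$ by toggling $s_{jk}$ for all $j,k$ such that $i,j,k$ are pairwise distinct and $s_{ij}\neq 0\neq s_{ik}$. (All other entries, in particular all diagonal entries, are unchanged.) For zero-diagonal symmetric matrices, $S\sim_{lc}T$ means that $T$ can be obtained from $S$ through a finite (possibly empty) sequence of simple local complementations. Modified inverse: if $S$ is a zero-diagonal symmetric matrix, a modified inverse of $S$ is a zero-diagonal symmetric matrix obtained as follows: first toggle some (possibly no) diagonal entries of $S$ to obtain an invertible symmetric matrix $S'$, and then toggle every nonzero diagonal entry of $(S')^{-1}$. For zero-diagonal symmetric matrices, $S\sim_{mi}T$ means that $T$ can be obtained from $S$ through a finite (possibly empty) sequence of modified inversions (i.e. each matrix in the sequence is a modified inverse of the preceding one). *)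

theory Defs
  imports "HOL-Analysis.Determinants" "HOL-Library.Z2"
begin

text \<open>
  The type \<open>bit\<close> is the two-element field, and the finite index type \<open>'v\<close> plays the role of
  the index set \<open>V\<close>.
\<close>

type_synonym 'v gf2_matrix = "bit ^ 'v ^ 'v"

definition symmetric_mat :: "'v::finite gf2_matrix \<Rightarrow> bool" where
  "symmetric_mat S \<longleftrightarrow> (\<forall>i j. i \<noteq> j \<longrightarrow> S $ i $ j = S $ j $ i)"

definition zero_diagonal :: "'v::finite gf2_matrix \<Rightarrow> bool" where
  "zero_diagonal S \<longleftrightarrow> (\<forall>i. S $ i $ i = 0)"

definition simple_local_complement :: "'v::finite gf2_matrix \<Rightarrow> 'v \<Rightarrow> 'v gf2_matrix" where
  "simple_local_complement S i =
     (\<chi> j k. if i \<noteq> j \<and> i \<noteq> k \<and> j \<noteq> k \<and> S $ i $ j \<noteq> 0 \<and> S $ i $ k \<noteq> 0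
             then S $ j $ k + 1 else S $ j $ k)"

definition toggle_diagonal :: "'v set \<Rightarrow> 'v::finite gf2_matrix \<Rightarrow> 'v gf2_matrix" where
  "toggle_diagonal D S = (\<chi> j k. if j = k \<and> j \<in> D then S $ j $ k + 1 else S $ j $ k)"

definition is_modified_inverse :: "'v::finite gf2_matrix \<Rightarrow> 'v gf2_matrix \<Rightarrow> bool" where
  "is_modified_inverse S T \<longleftrightarrow>
     (\<exists>D. let S' = toggle_diagonal D S; N = matrix_inv S'
          in invertible S' \<and> T = toggle_diagonal {i. N $ i $ i \<noteq> 0} N)"

definition sim_lc :: "'v::finite gf2_matrix \<Rightarrow> 'v gf2_matrix \<Rightarrow> bool"  (infix "\<sim>\<^sub>l\<^sub>c" 50) where
  "S \<sim>\<^sub>l\<^sub>c T \<longleftrightarrow> (\<lambda>A B. \<exists>i. B = simple_local_complement A i)\<^sup>*\<^sup>* S T"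

definition sim_mi :: "'v::finite gf2_matrix \<Rightarrow> 'v gf2_matrix \<Rightarrow> bool"  (infix "\<sim>\<^sub>m\<^sub>i" 50) where
  "S \<sim>\<^sub>m\<^sub>i T \<longleftrightarrow> is_modified_inverse\<^sup>*\<^sup>* S T"

text \<open>
  Both operations stay within the zero-diagonal symmetric matrices, so the sequences in
  \<open>sim_lc\<close> and \<open>sim_mi\<close> that start at such a matrix consist of such matrices only.
\<close>

lemma simple_local_complement_preserves:
  assumes "symmetric_mat S" "zero_diagonal S"
  shows "symmetric_mat (simple_local_complement S i)" "zero_diagonal (simple_local_complement S i)"
  using assms by (auto simp: symmetric_mat_def zero_diagonal_def simple_local_complement_def)

lemma symmetric_mat_iff_transpose: "symmetric_mat S \<longleftrightarrow> transpose S = S"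
  unfolding symmetric_mat_def transpose_def vec_eq_iff by simp metis

lemma symmetric_mat_toggle_diagonal:
  "symmetric_mat (toggle_diagonal D S) \<longleftrightarrow> symmetric_mat S"
  by (auto simp: symmetric_mat_def toggle_diagonal_def)

lemma symmetric_mat_matrix_inv:
  assumes "symmetric_mat S" "invertible S"
  shows "symmetric_mat (matrix_inv S)"
proof -
  let ?N = "matrix_inv S"
  have N: "S ** ?N = mat 1" "?N ** S = mat 1"
    using assms(2) someI_ex[of "\<lambda>A'. S ** A' = mat 1 \<and> A' ** S = mat 1"]
    unfolding matrix_inv_def invertible_def by auto
  have "transpose ?N ** S = mat 1"
    using arg_cong[OF N(1), of transpose] assms(1)
    by (simp add: matrix_transpose_mul symmetric_mat_iff_transpose transpose_mat)
  then have "transpose ?N = ?N"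
    by (metis N(1) matrix_mul_assoc matrix_mul_lid matrix_mul_rid)
  then show ?thesis
    by (simp add: symmetric_mat_iff_transpose)
qed

lemma modified_inverse_preserves:
  assumes "symmetric_mat S" "is_modified_inverse S T"
  shows "symmetric_mat T" "zero_diagonal T"
proof -
  obtain D where D: "invertible (toggle_diagonal D S)"
    "T = toggle_diagonal {i. matrix_inv (toggle_diagonal D S) $ i $ i \<noteq> 0}
           (matrix_inv (toggle_diagonal D S))"
    using assms(2) by (auto simp: is_modified_inverse_def Let_def)
  show "symmetric_mat T"
    using D assms(1) by (simp add: symmetric_mat_toggle_diagonal symmetric_mat_matrix_inv)
  show "zero_diagonal T"
    by (auto simp: D(2) zero_diagonal_def toggle_diagonal_def)
qed

end

theory Submission
  imports Defs
begin

text \<open>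
  A looped version of \<open>S\<close> is a matrix \<open>M = S + D\<close> with \<open>D\<close> diagonal. If \<open>s\<^sub>i\<close> denotes the \<open>i\<close>-th
  column of \<open>S\<close>, then adding the matrix \<open>s\<^sub>i s\<^sub>i\<^sup>T\<close> to \<open>M\<close> gives a looped version
  \<open>M'\<close> of the simple local complement of \<open>S\<close> at \<open>i\<close>; here the diagonal is toggled at the
  neighbours of \<open>i\<close>. The whole proof rests on how the graph \<open>{(x, M x)}\<close> changes under this
  operation. If \<open>D\<close> has no entry at \<open>i\<close>, then \<open>(x, y)\<close> becomes \<open>(x + y\<^sub>i e\<^sub>i, y)\<close>. If \<open>D\<close> has
  an entry at \<open>i\<close>, then the coordinates \<open>x\<^sub>i\<close> and \<open>y\<^sub>i\<close> are exchanged, so that \<open>M'\<close> is the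
  principal pivot transform of \<open>M\<close> at \<open>{i}\<close>.

  Local complements arise by modified inversions: if \<open>i\<close> is not isolated, some invertible \<open>M\<close> has no
  diagonal entry at \<open>i\<close> (enlarge the nonsingular principal submatrix on \<open>i\<close> and a neighbour one
  index at a time, choosing each new diagonal entry suitably). By the first rule, \<open>M'\<close> is
  invertible and its inverse differs from that of \<open>M\<close> only in the entry \<open>(i, i)\<close>. So \<open>S\<close> and its
  local complement have a common modified inverse, and modified inversion is a symmetric relation.

  Modified inverses arise by local complementations: the inverse of \<open>M\<close> is its principal pivot transform on
  the full index set. More generally, suppose that a looped version of \<open>T\<close> is the principal pivot
  transform on \<open>W\<close> of a looped version of \<open>S\<close>, and induct on the size of \<open>W\<close>. If \<open>W\<close> is
  empty, then \<open>S = T\<close>, as both have zero diagonal. Otherwise, by the second rule,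
  a local complementation at an index of \<open>W\<close> with a nonzero diagonal entry removes that index from
  \<open>W\<close>. If there is no such index, then two indices of \<open>W\<close> are adjacent, and a local
  complementation at one makes the diagonal entry at the other nonzero, leaving \<open>W\<close> unchanged.
\<close>

section \<open>Looped matrices and local complements\<close>

lemma bit_add_self: "b + b = (0::bit)"
  by (cases b) simp_all

lemma bit_add_self_left: "b + (b + c) = (c::bit)"
  by (cases b; cases c) simp_all

lemma matrix_vector_mult_axis_nth:
  fixes A :: "'a::semiring_1 ^ 'n::finite ^ 'm"
  shows "(A *v axis i c) $ j = A $ j $ i * c"
  by (simp add: matrix_vector_mult_def axis_def if_distrib cong: if_cong)

lemma toggle_diagonal_mult_nth:
  "(toggle_diagonal D S *v x) $ j = (S *v x) $ j + (if j \<in> D then x $ j else 0)"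
proof -
  have "toggle_diagonal D S $ j $ k * x $ k
        = S $ j $ k * x $ k + (if k = j then if j \<in> D then x $ j else 0 else 0)" for k
    by (auto simp: toggle_diagonal_def distrib_right)
  then show ?thesis
    by (simp only: matrix_vector_mult_def vec_lambda_beta sum.distrib sum.delta finite UNIV_I if_True)
qed

lemma toggle_diagonal_toggle_diagonal:
  "toggle_diagonal D (toggle_diagonal E S) = toggle_diagonal (sym_diff D E) S"
  by (auto simp: toggle_diagonal_def vec_eq_iff bit_add_self add.assoc)

lemma toggle_diagonal_empty: "toggle_diagonal {} S = S"
  by (simp add: toggle_diagonal_def vec_eq_iff)

lemma toggle_diagonal_inject_zero_diagonal:
  assumes "zero_diagonal S" "zero_diagonal T" "toggle_diagonal D S = toggle_diagonal E T"
  shows "S = T"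
proof -
  have "S $ j $ k = T $ j $ k" for j k
    using assms(1,2) arg_cong[OF assms(3), of "\<lambda>M. M $ j $ k"]
    by (cases "j = k") (auto simp: toggle_diagonal_def zero_diagonal_def)
  then show ?thesis
    by (simp add: vec_eq_iff)
qed

lemma simple_local_complement_involution:
  "simple_local_complement (simple_local_complement S i) i = S"
  by (auto simp: simple_local_complement_def vec_eq_iff)

lemma simple_local_complement_row:
  "simple_local_complement S i $ i = S $ i"
  by (simp add: simple_local_complement_def vec_eq_iff)

lemma simple_local_complement_mult_nth:
  assumes "zero_diagonal S"
  shows "(simple_local_complement S i *v x) $ j
         = (S *v x) $ j + S $ i $ j * ((S *v x) $ i + x $ j)"
proof -
  have z: "S $ k $ k = 0" for k
    using assms by (simp add: zero_diagonal_def)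
  have "simple_local_complement S i $ j $ k * x $ k
        = S $ j $ k * x $ k + S $ i $ j * (S $ i $ k * x $ k + (if k = j then x $ j else 0))" for k
    using z[of i] z[of j]
    by (cases "S $ i $ j"; cases "S $ i $ k"; cases "x $ k")
       (auto simp: simple_local_complement_def)
  then show ?thesis
    by (simp only: matrix_vector_mult_def vec_lambda_beta sum.distrib sum.delta finite UNIV_I
        if_True flip: sum_distrib_left)
qed

text \<open>
  For symmetric zero-diagonal \<open>S\<close>, the looped version of the local complement at \<open>i\<close> obtained by adding \<open>s\<^sub>i s\<^sub>i\<^sup>T\<close>, where \<open>s\<^sub>i\<close>
  is the \<open>i\<close>-th column of \<open>S\<close>, to the looped version \<open>toggle_diagonal D S\<close> of \<open>S\<close>.
\<close>

definition looped_local_complement ::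
    "'v set \<Rightarrow> 'v::finite gf2_matrix \<Rightarrow> 'v \<Rightarrow> 'v gf2_matrix" where
  "looped_local_complement D S i =
     toggle_diagonal (sym_diff D {j. S $ i $ j \<noteq> 0}) (simple_local_complement S i)"

lemma looped_local_complement_mult_nth:
  assumes "zero_diagonal S"
  shows "(looped_local_complement D S i *v x) $ j
         = (toggle_diagonal D S *v x) $ j + S $ i $ j * (S *v x) $ i"
  using assms
  by (cases "x $ j"; cases "S $ i $ j"; cases "(S *v x) $ j"; cases "(S *v x) $ i")
     (auto simp: looped_local_complement_def toggle_diagonal_mult_nth
       simple_local_complement_mult_nth)

lemma looped_local_complement_involution:
  "looped_local_complement (sym_diff D {j. S $ i $ j \<noteq> 0}) (simple_local_complement S i) i
         = toggle_diagonal D S"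
proof -
  have "sym_diff (sym_diff D A) A = D" for A :: "'a set"
    by auto
  then show ?thesis
    by (simp add: looped_local_complement_def simple_local_complement_involution
        simple_local_complement_row)
qed

text \<open>
  If \<open>(x, y)\<close> lies in the graph of \<open>toggle_diagonal D S\<close> and \<open>i \<notin> D\<close>, then \<open>(x + y\<^sub>i e\<^sub>i, y)\<close>
  lies in the graph of the looped local complement.
\<close>

lemma looped_local_complement_unlooped:
  assumes "symmetric_mat S" "zero_diagonal S" "i \<notin> D"
    and y: "y = toggle_diagonal D S *v x"
  shows "looped_local_complement D S i *v (x + axis i (y $ i)) = y"
proof -
  have sym: "S $ i $ j = S $ j $ i" for j
    using assms(1) by (metis symmetric_mat_def)
  have z: "S $ i $ i = 0"
    using assms(2) by (simp add: zero_diagonal_def)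
  have yi: "y $ i = (S *v x) $ i"
    using assms(3) by (simp add: y toggle_diagonal_mult_nth)
  have "(looped_local_complement D S i *v (x + axis i (y $ i))) $ j = y $ j" for j
  proof -
    have "(toggle_diagonal D S *v axis i (y $ i)) $ j = S $ i $ j * y $ i"
      using assms(3) sym[of j] unfolding matrix_vector_mult_axis_nth
      by (cases "j = i") (simp_all add: toggle_diagonal_def axis_def z)
    moreover have "(S *v axis i (y $ i)) $ i = 0"
      by (simp add: matrix_vector_mult_axis_nth z)
    ultimately show ?thesis
      unfolding looped_local_complement_mult_nth[OF assms(2)] matrix_vector_right_distrib
        vector_add_component y[symmetric] yi[symmetric]
      by (cases "y $ j"; cases "y $ i"; cases "S $ i $ j") simp_all
  qed
  then show ?thesis
    by (simp add: vec_eq_iff)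
qed

text \<open>
  If \<open>i \<in> D\<close>, the looped local complement exchanges the coordinates at \<open>i\<close>: adding \<open>x\<^sub>i + y\<^sub>i\<close>
  to each of \<open>x\<^sub>i\<close> and \<open>y\<^sub>i\<close> swaps them.
\<close>

lemma looped_local_complement_looped:
  assumes "symmetric_mat S" "zero_diagonal S" "i \<in> D"
    and y: "y = toggle_diagonal D S *v x" and c: "c = x $ i + y $ i"
  shows "looped_local_complement D S i *v (x + axis i c) = y + axis i c"
proof -
  have sym: "S $ i $ j = S $ j $ i" for j
    using assms(1) by (metis symmetric_mat_def)
  have z: "S $ i $ i = 0"
    using assms(2) by (simp add: zero_diagonal_def)
  have ci: "(S *v x) $ i = c"
    using assms(3) by (cases "x $ i") (auto simp: y c toggle_diagonal_mult_nth)
  have "(looped_local_complement D S i *v (x + axis i c)) $ j = (y + axis i c) $ j" for j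
  proof -
    have "(toggle_diagonal D S *v axis i c) $ j = S $ i $ j * c + axis i c $ j"
      using assms(3) sym[of j] unfolding matrix_vector_mult_axis_nth
      by (cases "j = i") (simp_all add: toggle_diagonal_def axis_def z)
    moreover have "(S *v axis i c) $ i = 0"
      by (simp add: matrix_vector_mult_axis_nth z)
    ultimately show ?thesis
      unfolding looped_local_complement_mult_nth[OF assms(2)] matrix_vector_right_distrib
        vector_add_component y[symmetric] ci
      by (cases "y $ j"; cases c; cases "S $ i $ j"; cases "axis i c $ j") simp_all
  qed
  then show ?thesis
    by (simp add: vec_eq_iff)
qed

section \<open>Modified inversion\<close>

lemma matrix_inv_inverse:
  assumes "invertible A"
  shows "A ** matrix_inv A = mat 1" "matrix_inv A ** A = mat 1"
  using assms someI_ex[of "\<lambda>B. A ** B = mat 1 \<and> B ** A = mat 1"]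
  unfolding matrix_inv_def invertible_def by auto

text \<open>
  As \<open>T\<close> has zero diagonal, it is recovered from any \<open>toggle_diagonal E T\<close> by toggling the nonzero
  diagonal entries.
\<close>

lemma is_modified_inverse_iff:
  assumes "zero_diagonal T"
  shows "is_modified_inverse S T
         \<longleftrightarrow> (\<exists>D E. toggle_diagonal D S ** toggle_diagonal E T = mat 1)"
proof
  assume "is_modified_inverse S T"
  then obtain D N where D: "invertible (toggle_diagonal D S)"
      and N: "N = matrix_inv (toggle_diagonal D S)"
      and T: "T = toggle_diagonal {i. N $ i $ i \<noteq> 0} N"
    by (auto simp: is_modified_inverse_def Let_def)
  have "toggle_diagonal {i. N $ i $ i \<noteq> 0} T = N"
    by (simp add: T toggle_diagonal_toggle_diagonal toggle_diagonal_empty)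
  then have "toggle_diagonal D S ** toggle_diagonal {i. N $ i $ i \<noteq> 0} T = mat 1"
    using D N by (simp add: matrix_inv_inverse(1))
  then show "\<exists>D E. toggle_diagonal D S ** toggle_diagonal E T = mat 1"
    by blast
next
  assume "\<exists>D E. toggle_diagonal D S ** toggle_diagonal E T = mat 1"
  then obtain D E where DE: "toggle_diagonal D S ** toggle_diagonal E T = mat 1"
    by blast
  define N where "N = toggle_diagonal E T"
  have inv: "invertible (toggle_diagonal D S)"
    using DE matrix_left_right_inverse unfolding invertible_def by blast
  have N: "matrix_inv (toggle_diagonal D S) = N"
    by (metis DE N_def inv matrix_inv_inverse(2) matrix_mul_assoc matrix_mul_lid matrix_mul_rid)
  have "{i. N $ i $ i \<noteq> 0} = E"
    using assms by (auto simp: N_def toggle_diagonal_def zero_diagonal_def)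
  then have "T = toggle_diagonal {i. N $ i $ i \<noteq> 0} N"
    by (simp add: N_def toggle_diagonal_toggle_diagonal toggle_diagonal_empty)
  then show "is_modified_inverse S T"
    using inv N by (auto simp: is_modified_inverse_def Let_def)
qed

lemma is_modified_inverse_sym:
  assumes "zero_diagonal S" "zero_diagonal T" "is_modified_inverse S T"
  shows "is_modified_inverse T S"
  using assms(3) unfolding is_modified_inverse_iff[OF assms(1)] is_modified_inverse_iff[OF assms(2)]
  using matrix_left_right_inverse by blast

section \<open>Local complements by modified inversions\<close>

text \<open>Nonsingularity of the principal submatrix of \<open>M\<close> with index set \<open>W\<close>.\<close>

definition nonsingular_on :: "'v set \<Rightarrow> 'v::finite gf2_matrix \<Rightarrow> bool" where
  "nonsingular_on W M \<longleftrightarrow>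
     (\<forall>x. (\<forall>j. j \<notin> W \<longrightarrow> x $ j = 0) \<and> (\<forall>j\<in>W. (M *v x) $ j = 0) \<longrightarrow> x = 0)"

text \<open>
  Toggling the diagonal entry at the new index \<open>k\<close> adds the determinant of the submatrix on \<open>W\<close>
  to that of the submatrix on \<open>insert k W\<close>, so one of the two choices is nonsingular.
\<close>

lemma nonsingular_on_insert:
  assumes "nonsingular_on W M" "k \<notin> W"
  shows "nonsingular_on (insert k W) M \<or> nonsingular_on (insert k W) (toggle_diagonal {k} M)"
proof (rule ccontr)
  assume "\<not> ?thesis"
  then obtain x y where
    x: "\<forall>j. j \<notin> insert k W \<longrightarrow> x $ j = 0" "\<forall>j\<in>insert k W. (M *v x) $ j = 0" "x \<noteq> 0" and
    y: "\<forall>j. j \<notin> insert k W \<longrightarrow> y $ j = 0"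
       "\<forall>j\<in>insert k W. (toggle_diagonal {k} M *v y) $ j = 0" "y \<noteq> 0"
    unfolding nonsingular_on_def by blast
  have My: "(M *v y) $ j = 0" if "j \<in> W" for j
  proof -
    have "(toggle_diagonal {k} M *v y) $ j = 0" "j \<noteq> k"
      using y(2) that assms(2) by auto
    then show ?thesis
      by (simp add: toggle_diagonal_mult_nth)
  qed
  have vanish: "z = 0" if "\<forall>j. j \<notin> W \<longrightarrow> z $ j = 0" "\<And>j. j \<in> W \<Longrightarrow> (M *v z) $ j = 0" for z
    using assms(1) that unfolding nonsingular_on_def by blast
  have xk: "x $ k \<noteq> 0"
  proof
    assume "x $ k = 0"
    then have "\<forall>j. j \<notin> W \<longrightarrow> x $ j = 0"
      using x(1) by (metis insert_iff)
    then show False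
      using vanish[of x] x(2,3) by blast
  qed
  have yk: "y $ k \<noteq> 0"
  proof
    assume "y $ k = 0"
    then have "\<forall>j. j \<notin> W \<longrightarrow> y $ j = 0"
      using y(1) by (metis insert_iff)
    then show False
      using vanish[of y] My y(3) by blast
  qed
  have "(x + y) $ j = 0" if "j \<notin> W" for j
    using xk yk x(1) y(1) that by (cases "j = k") simp_all
  moreover have "(M *v (x + y)) $ j = 0" if "j \<in> W" for j
    using x(2) My that by (simp add: matrix_vector_right_distrib)
  ultimately have "x + y = 0"
    by (intro vanish) blast+
  then have "x $ j + y $ j = 0" for j
    by (metis vector_add_component zero_index)
  then have "y $ j = x $ j" for j
    by (metis add.right_neutral bit_add_self_left)
  then have "y = x"
    by (simp add: vec_eq_iff)
  then show False
    using x(2) y(2) yk by (auto simp: toggle_diagonal_mult_nth)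
qed

lemma nonsingular_on_extend:
  assumes "nonsingular_on W M"
  shows "\<exists>D. D \<inter> W = {} \<and> invertible (toggle_diagonal D M)"
  using assms
proof (induction "card (- W)" arbitrary: W M)
  case 0
  then have "W = UNIV"
    by auto
  then have "\<forall>x. M *v x = 0 \<longrightarrow> x = 0"
    using "0.prems" by (simp add: nonsingular_on_def vec_eq_iff)
  then have "invertible M"
    using matrix_left_invertible_ker[of M] matrix_left_right_inverse
    unfolding invertible_def by metis
  then show ?case
    by (metis inf_bot_left toggle_diagonal_empty)
next
  case (Suc n)
  then obtain k where k: "k \<notin> W"
    by (metis ComplD card_eq_0_iff equals0I nat.simps(3))
  obtain E where E: "E \<subseteq> {k}" "nonsingular_on (insert k W) (toggle_diagonal E M)"
    using nonsingular_on_insert[OF Suc.prems k]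
    by (metis empty_subsetI order_refl toggle_diagonal_empty)
  have "- insert k W = - W - {k}"
    by auto
  then have "n = card (- insert k W)"
    using Suc.hyps(2) k by simp
  from Suc.hyps(1)[OF this E(2)] obtain D where
    "D \<inter> insert k W = {}" "invertible (toggle_diagonal D (toggle_diagonal E M))"
    by blast
  then show ?case
    using E(1) k by (intro exI[of _ "sym_diff D E"]) (auto simp: toggle_diagonal_toggle_diagonal)
qed

lemma nonsingular_on_edge:
  assumes "symmetric_mat S" "zero_diagonal S" "S $ i $ j \<noteq> 0"
  shows "nonsingular_on {i, j} S"
  unfolding nonsingular_on_def
proof (intro allI impI)
  fix x
  assume x: "(\<forall>k. k \<notin> {i, j} \<longrightarrow> x $ k = 0) \<and> (\<forall>k\<in>{i, j}. (S *v x) $ k = 0)"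
  have ij: "i \<noteq> j"
    using assms(2,3) by (auto simp: zero_diagonal_def)
  have s: "S $ i $ i = 0" "S $ j $ j = 0" "S $ i $ j = 1" "S $ j $ i = 1"
    using assms ij by (auto simp: zero_diagonal_def symmetric_mat_def)
  have "x = axis i (x $ i) + axis j (x $ j)"
    using x ij by (auto simp: vec_eq_iff axis_def)
  then have "(S *v x) $ k = S $ k $ i * x $ i + S $ k $ j * x $ j" for k
    by (metis matrix_vector_mult_axis_nth matrix_vector_right_distrib vector_add_component)
  then have "x $ i = 0" "x $ j = 0"
    using x s by simp_all
  then have "x $ k = 0" for k
    using x by (cases "k \<in> {i, j}") auto
  then show "x = 0"
    by (simp add: vec_eq_iff)
qed

lemma common_modified_inverse:
  assumes S: "symmetric_mat S" "zero_diagonal S" and "S $ i $ j \<noteq> 0"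
  shows "\<exists>T. is_modified_inverse S T \<and> is_modified_inverse (simple_local_complement S i) T"
proof -
  obtain D where D: "D \<inter> {i, j} = {}" "invertible (toggle_diagonal D S)"
    using nonsingular_on_extend[OF nonsingular_on_edge[OF assms]] by blast
  define T where "T = toggle_diagonal {k. matrix_inv (toggle_diagonal D S) $ k $ k \<noteq> 0}
                        (matrix_inv (toggle_diagonal D S))"
  have T: "is_modified_inverse S T"
    using D(2) by (auto simp: T_def is_modified_inverse_def Let_def)
  then have zT: "zero_diagonal T"
    using modified_inverse_preserves(2)[OF S(1)] by simp
  define N where "N = matrix_inv (toggle_diagonal D S)"
  define E where "E = {k. N $ k $ k \<noteq> 0}"
  have N: "N = toggle_diagonal E T"
    by (simp add: T_def N_def E_def toggle_diagonal_toggle_diagonal toggle_diagonal_empty)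
  \<comment> \<open>The inverses for \<open>S\<close> and for its local complement differ only in the entry \<open>(i, i)\<close>.\<close>
  have "looped_local_complement D S i *v (toggle_diagonal {i} N *v x) = x" for x
  proof -
    have "x = toggle_diagonal D S *v (N *v x)"
      using D(2) by (simp add: N_def matrix_vector_mul_assoc matrix_inv_inverse(1))
    moreover have "toggle_diagonal {i} N *v x = N *v x + axis i (x $ i)"
      by (auto simp: vec_eq_iff toggle_diagonal_mult_nth axis_def)
    ultimately show ?thesis
      using looped_local_complement_unlooped[OF S, of i D x "N *v x"] D(1) by simp
  qed
  then have "looped_local_complement D S i ** toggle_diagonal {i} N = mat 1"
    by (simp add: matrix_eq flip: matrix_vector_mul_assoc)
  then have "is_modified_inverse (simple_local_complement S i) T"
    unfolding is_modified_inverse_iff[OF zT] looped_local_complement_def N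
      toggle_diagonal_toggle_diagonal by blast
  with T show ?thesis
    by blast
qed

lemma sim_mi_trans: "S \<sim>\<^sub>m\<^sub>i T \<Longrightarrow> T \<sim>\<^sub>m\<^sub>i U \<Longrightarrow> S \<sim>\<^sub>m\<^sub>i U"
  unfolding sim_mi_def by (rule rtranclp_trans)

lemma sim_mi_simple_local_complement:
  assumes S: "symmetric_mat S" "zero_diagonal S"
  shows "S \<sim>\<^sub>m\<^sub>i simple_local_complement S i"
proof (cases "\<exists>j. S $ i $ j \<noteq> 0")
  case True
  then obtain T where T: "is_modified_inverse S T"
      "is_modified_inverse (simple_local_complement S i) T"
    using common_modified_inverse[OF S] by blast
  have "is_modified_inverse T (simple_local_complement S i)"
    using is_modified_inverse_sym T(2) simple_local_complement_preserves(2)[OF S]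
      modified_inverse_preserves(2)[OF S(1) T(1)] by blast
  with T(1) show ?thesis
    unfolding sim_mi_def by (rule rtranclp.rtrancl_into_rtrancl[OF r_into_rtranclp])
next
  case False
  then have "simple_local_complement S i = S"
    by (auto simp: simple_local_complement_def vec_eq_iff)
  then show ?thesis
    by (simp add: sim_mi_def)
qed

lemma sim_lc_imp_sim_mi:
  assumes S: "symmetric_mat S" "zero_diagonal S" and "S \<sim>\<^sub>l\<^sub>c T"
  shows "S \<sim>\<^sub>m\<^sub>i T"
proof -
  have "symmetric_mat T \<and> zero_diagonal T \<and> S \<sim>\<^sub>m\<^sub>i T"
    using assms(3) unfolding sim_lc_def
  proof (induction rule: rtranclp_induct)
    case base
    then show ?case
      using S by (simp add: sim_mi_def)
  next
    case (step T U)
    then obtain i where U: "U = simple_local_complement T i"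
      by blast
    have T: "symmetric_mat T" "zero_diagonal T" "S \<sim>\<^sub>m\<^sub>i T"
      using step.IH by auto
    have "S \<sim>\<^sub>m\<^sub>i U"
      unfolding U using sim_mi_trans[OF T(3) sim_mi_simple_local_complement[OF T(1,2)]] .
    then show ?case
      using simple_local_complement_preserves[OF T(1,2)] U by simp
  qed
  then show ?thesis
    by blast
qed

section \<open>Modified inverses by local complementations\<close>

text \<open>
  The vector that agrees with \<open>y\<close> on \<open>W\<close> and with \<open>x\<close> elsewhere. The pair
  \<open>(exchange W x y, exchange W y x)\<close> is \<open>(x, y)\<close> with the coordinates in \<open>W\<close> swapped.
\<close>

definition exchange :: "'v set \<Rightarrow> bit ^ 'v::finite \<Rightarrow> bit ^ 'v \<Rightarrow> bit ^ 'v" where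
  "exchange W x y = (\<chi> j. if j \<in> W then y $ j else x $ j)"

text \<open>
  \<open>N\<close> is the principal pivot transform of \<open>M\<close> on \<open>W\<close>: swapping the coordinates in \<open>W\<close> maps the
  graph of \<open>M\<close> into that of \<open>N\<close>. Nonsingularity of the principal submatrix of \<open>M\<close> on \<open>W\<close> is not
  required separately; it follows from the existence of \<open>N\<close>.
\<close>

definition pivot_transform :: "'v set \<Rightarrow> 'v::finite gf2_matrix \<Rightarrow> 'v gf2_matrix \<Rightarrow> bool" where
  "pivot_transform W M N \<longleftrightarrow>
     (\<forall>x. N *v exchange W x (M *v x) = exchange W (M *v x) x)"

lemma exchange_empty: "exchange {} x y = x"
  by (simp add: exchange_def vec_eq_iff)

lemma exchange_UNIV: "exchange UNIV x y = y"
  by (simp add: exchange_def vec_eq_iff)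

text \<open>Complementing at a looped index of \<open>W\<close> already performs the exchange at that index.\<close>

lemma pivot_transform_looped:
  assumes S: "symmetric_mat S" "zero_diagonal S" and i: "i \<in> D" "i \<in> W"
    and N: "pivot_transform W (toggle_diagonal D S) N"
  shows "pivot_transform (W - {i}) (looped_local_complement D S i) N"
  unfolding pivot_transform_def
proof
  fix x
  define y where "y = looped_local_complement D S i *v x"
  define c where "c = x $ i + y $ i"
  have "i \<in> sym_diff D {j. S $ i $ j \<noteq> 0}"
    using i(1) S(2) by (simp add: zero_diagonal_def)
  \<comment> \<open>Complementing the local complement at \<open>i\<close> again gives back \<open>S\<close>, so the exchange rule applies backwards.\<close>
  from looped_local_complement_looped[OF simple_local_complement_preserves[OF S] this
      y_def[unfolded looped_local_complement_def] c_def]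
  have "toggle_diagonal D S *v (x + axis i c) = y + axis i c"
    unfolding looped_local_complement_involution .
  then have "N *v exchange W (x + axis i c) (y + axis i c)
             = exchange W (y + axis i c) (x + axis i c)"
    using N unfolding pivot_transform_def by metis
  moreover have "exchange W (x + axis i c) (y + axis i c) = exchange (W - {i}) x y"
    "exchange W (y + axis i c) (x + axis i c) = exchange (W - {i}) y x"
    using i(2) by (auto simp: exchange_def vec_eq_iff axis_def c_def add_ac
        bit_add_self bit_add_self_left)
  ultimately show "N *v exchange (W - {i}) x (looped_local_complement D S i *v x)
                   = exchange (W - {i}) (looped_local_complement D S i *v x) x"
    by (simp add: y_def)
qed

text \<open>
  At an unlooped index \<open>i\<close> of \<open>W\<close>, the term \<open>y\<^sub>i\<close> added to \<open>x\<^sub>i\<close> becomes, after the exchange, a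
  term that \<open>N\<close> absorbs in its diagonal entry at \<open>i\<close>.
\<close>

lemma pivot_transform_unlooped:
  assumes S: "symmetric_mat S" "zero_diagonal S" and i: "i \<notin> D" "i \<in> W"
    and N: "pivot_transform W (toggle_diagonal D S) N"
  shows "pivot_transform W (looped_local_complement D S i) (toggle_diagonal {i} N)"
  unfolding pivot_transform_def
proof
  fix x
  define y where "y = looped_local_complement D S i *v x"
  have "i \<notin> sym_diff D {j. S $ i $ j \<noteq> 0}"
    using i(1) S(2) by (simp add: zero_diagonal_def)
  from looped_local_complement_unlooped[OF simple_local_complement_preserves[OF S] this
      y_def[unfolded looped_local_complement_def]]
  have "toggle_diagonal D S *v (x + axis i (y $ i)) = y"
    unfolding looped_local_complement_involution .
  then have "N *v exchange W (x + axis i (y $ i)) y = exchange W y (x + axis i (y $ i))"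
    using N unfolding pivot_transform_def by metis
  moreover have "exchange W (x + axis i (y $ i)) y = exchange W x y"
    using i(2) by (auto simp: exchange_def vec_eq_iff axis_def)
  ultimately have "N *v exchange W x y = exchange W y (x + axis i (y $ i))"
    by simp
  then have "toggle_diagonal {i} N *v exchange W x y = exchange W y x"
    using i(2) by (auto simp: toggle_diagonal_mult_nth vec_eq_iff exchange_def axis_def
        add.assoc bit_add_self)
  then show "toggle_diagonal {i} N *v exchange W x (looped_local_complement D S i *v x)
             = exchange W (looped_local_complement D S i *v x) x"
    by (simp add: y_def)
qed

text \<open>The principal submatrix of \<open>M\<close> on \<open>W\<close> is nonsingular, so it has no zero column.\<close>

lemma pivot_transform_nonzero_column:
  assumes "pivot_transform W M N" "i \<in> W"
  shows "\<exists>j\<in>W. M $ j $ i \<noteq> 0"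
proof (rule ccontr)
  assume "\<not> ?thesis"
  then have z: "M $ j $ i = 0" if "j \<in> W" for j
    using that by blast
  let ?x = "axis i 1 :: bit ^ 'a"
  have "exchange W ?x (M *v ?x) $ j = 0" for j
  proof (cases "j \<in> W")
    case True
    then show ?thesis
      by (simp add: exchange_def matrix_vector_mult_axis_nth z)
  next
    case False
    then have "j \<noteq> i"
      using assms(2) by blast
    with False show ?thesis
      by (simp add: exchange_def axis_def)
  qed
  then have zero: "exchange W ?x (M *v ?x) = 0"
    by (simp add: vec_eq_iff)
  have "N *v exchange W ?x (M *v ?x) = exchange W (M *v ?x) ?x"
    using assms(1) unfolding pivot_transform_def by blast
  then have "exchange W (M *v ?x) ?x = 0"
    unfolding zero by simp
  then have "exchange W (M *v ?x) ?x $ i = 0"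
    by simp
  then show False
    using assms(2) by (simp add: exchange_def axis_def)
qed

lemma sim_lc_trans: "S \<sim>\<^sub>l\<^sub>c T \<Longrightarrow> T \<sim>\<^sub>l\<^sub>c U \<Longrightarrow> S \<sim>\<^sub>l\<^sub>c U"
  unfolding sim_lc_def by (rule rtranclp_trans)

lemma sim_lc_step: "simple_local_complement S i \<sim>\<^sub>l\<^sub>c T \<Longrightarrow> S \<sim>\<^sub>l\<^sub>c T"
  unfolding sim_lc_def by (rule converse_rtranclp_into_rtranclp) auto

lemma pivot_transform_imp_sim_lc:
  assumes "symmetric_mat S" "zero_diagonal S" "zero_diagonal T"
    and "pivot_transform W (toggle_diagonal D S) (toggle_diagonal E T)"
  shows "S \<sim>\<^sub>l\<^sub>c T"
  using assms
proof (induction "card W" arbitrary: W S D E rule: less_induct)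
  case less
  \<comment> \<open>An index of \<open>W\<close> with nonzero diagonal entry is removed by one local complementation.\<close>
  have looped: "S' \<sim>\<^sub>l\<^sub>c T"
    if S': "symmetric_mat S'" "zero_diagonal S'" and i: "i \<in> D'" "i \<in> W"
      and N: "pivot_transform W (toggle_diagonal D' S') (toggle_diagonal E' T)"
    for S' D' E' i
  proof -
    have "card (W - {i}) < card W"
      using i(2) by (simp add: card_Diff1_less del: card_Diff_insert)
    then have "simple_local_complement S' i \<sim>\<^sub>l\<^sub>c T"
      using less.hyps[OF _ simple_local_complement_preserves[OF S'] less.prems(3)]
        pivot_transform_looped[OF S' i N] unfolding looped_local_complement_def by blast
    then show ?thesis
      by (rule sim_lc_step)
  qed
  note S = less.prems(1,2) and N = less.prems(4)
  show ?case
  proof (cases "W = {}")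
    case True
    then have "toggle_diagonal D S = toggle_diagonal E T"
      using N by (simp add: pivot_transform_def exchange_empty matrix_eq)
    then have "S = T"
      using toggle_diagonal_inject_zero_diagonal less.prems(2,3) by blast
    then show ?thesis
      by (simp add: sim_lc_def)
  next
    case False
    show ?thesis
    proof (cases "W \<inter> D = {}")
      case False
      then show ?thesis
        using looped[OF S _ _ N] by blast
    next
      case True
      obtain i where i: "i \<in> W"
        using False by blast
      then obtain j where j: "j \<in> W" "toggle_diagonal D S $ j $ i \<noteq> 0"
        using pivot_transform_nonzero_column[OF N] by blast
      have "j \<notin> D" "i \<notin> D"
        using True i j(1) by auto
      then have "S $ j $ i \<noteq> 0"
        using j(2) by (auto simp: toggle_diagonal_def)
      then have "S $ i $ j \<noteq> 0"
        using S(1) unfolding symmetric_mat_def by metis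
      then have "j \<in> sym_diff D {k. S $ i $ k \<noteq> 0}"
        using \<open>j \<notin> D\<close> by simp
      \<comment> \<open>Complementing at \<open>i\<close> makes the diagonal entry at its neighbour \<open>j\<close> nonzero.\<close>
      moreover have "pivot_transform W
          (toggle_diagonal (sym_diff D {k. S $ i $ k \<noteq> 0}) (simple_local_complement S i))
          (toggle_diagonal (sym_diff {i} E) T)"
        using pivot_transform_unlooped[OF S \<open>i \<notin> D\<close> i N]
        unfolding looped_local_complement_def toggle_diagonal_toggle_diagonal .
      ultimately have "simple_local_complement S i \<sim>\<^sub>l\<^sub>c T"
        using j(1) by (intro looped[OF simple_local_complement_preserves[OF S]])
      then show ?thesis
        by (rule sim_lc_step)
    qed
  qed
qed

lemma is_modified_inverse_imp_sim_lc:
  assumes S: "symmetric_mat S" "zero_diagonal S" and T: "is_modified_inverse S T"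
  shows "S \<sim>\<^sub>l\<^sub>c T"
proof -
  have zT: "zero_diagonal T"
    using modified_inverse_preserves(2)[OF S(1) T] .
  then obtain D E where "toggle_diagonal D S ** toggle_diagonal E T = mat 1"
    using T is_modified_inverse_iff by blast
  then have "toggle_diagonal E T ** toggle_diagonal D S = mat 1"
    using matrix_left_right_inverse by blast
  then have "pivot_transform UNIV (toggle_diagonal D S) (toggle_diagonal E T)"
    by (simp add: pivot_transform_def exchange_UNIV matrix_vector_mul_assoc)
  then show ?thesis
    using pivot_transform_imp_sim_lc[OF S zT] by blast
qed

lemma sim_mi_imp_sim_lc:
  assumes S: "symmetric_mat S" "zero_diagonal S" and "S \<sim>\<^sub>m\<^sub>i T"
  shows "S \<sim>\<^sub>l\<^sub>c T"
proof -
  have "symmetric_mat T \<and> zero_diagonal T \<and> S \<sim>\<^sub>l\<^sub>c T"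
    using assms(3) unfolding sim_mi_def
  proof (induction rule: rtranclp_induct)
    case base
    then show ?case
      using S by (simp add: sim_lc_def)
  next
    case (step T U)
    have T: "symmetric_mat T" "zero_diagonal T" "S \<sim>\<^sub>l\<^sub>c T"
      using step.IH by auto
    have "S \<sim>\<^sub>l\<^sub>c U"
      using sim_lc_trans[OF T(3) is_modified_inverse_imp_sim_lc[OF T(1,2) step.hyps(2)]] .
    then show ?case
      using modified_inverse_preserves[OF T(1) step.hyps(2)] by simp
  qed
  then show ?thesis
    by blast
qed

theorem theorem13:
  fixes S T :: "bit ^ 'v::finite ^ 'v"
  assumes "symmetric_mat S" and "zero_diagonal S"
    and "symmetric_mat T" and "zero_diagonal T"
  shows "S \<sim>\<^sub>l\<^sub>c T \<longleftrightarrow> S \<sim>\<^sub>m\<^sub>i T"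
  using sim_lc_imp_sim_mi sim_mi_imp_sim_lc assms(1,2) by blast

end
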